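(* Let $t$ be a positive integer and $v_1<v_2<\cdots<v_{t+1}$ positive integers. A PDIMOA$^*(\prod_{i=2}^{t+1} v_i;t,t+1,(v_1,v_2,\dots,v_t,v_{t+1}))$ exists if and only if $v_1\mid v_i$ for all $2\le i\le t+1$.
   Context: A mixed orthogonal array MOA$(N;t,k,(v_1,\dots,v_k))$ is an $N\times k$ array whose $j$-th column has entries from a set $V_j$ with $|V_j|=v_j$, such that for every set $S$ of $t$ columns, each $t$-tuple in $\prod_{j\in S}V_j$ occurs as a row of the $N\times t$ subarray on $S$ the same number $\lambda_S$ of times ($\lambda_S=N/\prod_{j\in S}v_j$ is the index of $S$). It is a pairwise distinct index MOA, PDIMOA$(N;t,k,(v_1,\dots,v_k))$, if the $\binom{k}{t}$ indices $\lambda_S$ are pairwise distinct; it is a PDIMOA$^*$ if moreover $\lambda_S=1$ for some $S$. *)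

theory Defs
  imports Main "HOL-Library.FuncSet"
begin

text \<open>
  An \<open>N \<times> k\<close> array is a function \<open>A\<close> with rows \<open>{1..N}\<close> and columns \<open>{1..k}\<close>; only its values
  there matter. A tuple in the product of the \<open>V j\<close> over \<open>j \<in> S\<close> is an element of \<open>Pi\<^sub>E S V\<close>.
\<close>

definition row_count :: "nat \<Rightarrow> (nat \<Rightarrow> nat \<Rightarrow> 'a) \<Rightarrow> nat set \<Rightarrow> (nat \<Rightarrow> 'a) \<Rightarrow> nat" where
  "row_count N A S x = card {r \<in> {1..N}. \<forall>j\<in>S. A r j = x j}"

definition column_sets :: "nat \<Rightarrow> nat \<Rightarrow> nat set set" where
  "column_sets t k = {S. S \<subseteq> {1..k} \<and> card S = t}"

definition is_MOA ::
  "nat \<Rightarrow> nat \<Rightarrow> nat \<Rightarrow> (nat \<Rightarrow> nat) \<Rightarrow> (nat \<Rightarrow> 'a set) \<Rightarrow> (nat \<Rightarrow> nat \<Rightarrow> 'a) \<Rightarrow> bool" where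
  "is_MOA N t k v V A \<longleftrightarrow>
     (\<forall>j\<in>{1..k}. finite (V j) \<and> card (V j) = v j) \<and>
     (\<forall>r\<in>{1..N}. \<forall>j\<in>{1..k}. A r j \<in> V j) \<and>
     (\<forall>S\<in>column_sets t k. \<exists>l. \<forall>x\<in>Pi\<^sub>E S V. row_count N A S x = l)"

text \<open>The description below is unique for a MOA whose symbol sets \<open>V j\<close>, \<open>j \<in> S\<close>, are nonempty.\<close>

definition moa_index :: "nat \<Rightarrow> (nat \<Rightarrow> 'a set) \<Rightarrow> (nat \<Rightarrow> nat \<Rightarrow> 'a) \<Rightarrow> nat set \<Rightarrow> nat" where
  "moa_index N V A S = (THE l. \<forall>x\<in>Pi\<^sub>E S V. row_count N A S x = l)"

definition is_PDIMOA ::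
  "nat \<Rightarrow> nat \<Rightarrow> nat \<Rightarrow> (nat \<Rightarrow> nat) \<Rightarrow> (nat \<Rightarrow> 'a set) \<Rightarrow> (nat \<Rightarrow> nat \<Rightarrow> 'a) \<Rightarrow> bool" where
  "is_PDIMOA N t k v V A \<longleftrightarrow>
     is_MOA N t k v V A \<and> inj_on (moa_index N V A) (column_sets t k)"

definition is_PDIMOA_star ::
  "nat \<Rightarrow> nat \<Rightarrow> nat \<Rightarrow> (nat \<Rightarrow> nat) \<Rightarrow> (nat \<Rightarrow> 'a set) \<Rightarrow> (nat \<Rightarrow> nat \<Rightarrow> 'a) \<Rightarrow> bool" where
  "is_PDIMOA_star N t k v V A \<longleftrightarrow>
     is_PDIMOA N t k v V A \<and> (\<exists>S\<in>column_sets t k. moa_index N V A S = 1)"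

text \<open>
  Symbol sets are finite and may be renamed column by column, so taking the symbols to be natural
  numbers loses no generality.
\<close>

definition PDIMOA_star_exists :: "nat \<Rightarrow> nat \<Rightarrow> nat \<Rightarrow> (nat \<Rightarrow> nat) \<Rightarrow> bool" where
  "PDIMOA_star_exists N t k v \<longleftrightarrow>
     (\<exists>(V :: nat \<Rightarrow> nat set) A. is_PDIMOA_star N t k v V A)"

end

theory Submission imports Defs "HOL-Number_Theory.Cong" begin

text \<open>
  Omitting column \<open>j\<close> leaves index \<open>v j / v 1\<close>, so \<open>v 1\<close> divides every \<open>v j\<close>. Conversely, let
  the rows be all tuples of symbols in the columns \<open>2, \<dots>, t + 1\<close>, and let the entry in column
  \<open>1\<close> be the sum of the others modulo \<open>v 1\<close>. Once all entries but the one in column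
  \<open>j \<ge> 2\<close> are prescribed, that entry is determined modulo \<open>v 1\<close>, which leaves \<open>v j / v 1\<close> choices.
\<close>

text \<open>The complement of such a set has exactly one element. This lets every index be labelled
  by the omitted column.\<close>

lemma column_sets_Suc: "column_sets t (t + 1) = (\<lambda>j. {1..t+1} - {j}) ` {1..t+1}"
proof (intro equalityI subsetI)
  fix S assume "S \<in> column_sets t (t + 1)"
  then have S: "S \<subseteq> {1..t+1}" "card S = t"
    by (auto simp: column_sets_def)
  then have "card ({1..t+1} - S) = 1"
    using finite_subset[OF S(1)] by (subst card_Diff_subset) auto
  then obtain j where "{1..t+1} - S = {j}"
    by (rule card_1_singletonE)
  with S(1) have "S = {1..t+1} - {j}" "j \<in> {1..t+1}"
    by blast+
  then show "S \<in> (\<lambda>j. {1..t+1} - {j}) ` {1..t+1}"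
    by blast
qed (auto simp: column_sets_def)

text \<open>Each row restricts to exactly one tuple on \<open>S\<close>, so the fibres of
  \<open>restrict (A r) S\<close> partition the rows.\<close>

lemma sum_row_count:
  assumes "finite S" "\<And>j. j \<in> S \<Longrightarrow> finite (V j)"
    and "\<And>r j. r \<in> {1..N} \<Longrightarrow> j \<in> S \<Longrightarrow> A r j \<in> V j"
  shows "(\<Sum>x\<in>Pi\<^sub>E S V. row_count N A S x) = N"
proof -
  have "row_count N A S x = (\<Sum>r | r \<in> {1..N} \<and> restrict (A r) S = x. 1)" if "x \<in> Pi\<^sub>E S V" for x
  proof -
    have "restrict (A r) S = x \<longleftrightarrow> (\<forall>j\<in>S. A r j = x j)" for r
      using that by (auto simp: fun_eq_iff PiE_iff extensional_def)
    then show ?thesis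
      by (simp add: row_count_def)
  qed
  then have "(\<Sum>x\<in>Pi\<^sub>E S V. row_count N A S x) =
      (\<Sum>x\<in>Pi\<^sub>E S V. \<Sum>r | r \<in> {1..N} \<and> restrict (A r) S = x. 1)"
    by (rule sum.cong[OF refl])
  also have "\<dots> = (\<Sum>r\<in>{1..N}. 1)"
    using assms by (intro sum.group) (auto intro: finite_PiE)
  finally show ?thesis
    by simp
qed

text \<open>Double counting: \<open>row_count\<close> is constant over the tuples on
  \<open>S\<close> and sums to \<open>N\<close>. The cofactor \<open>l\<close> is the index of
  \<open>S\<close>.\<close>

lemma MOA_card:
  assumes "is_MOA N t k v V A" "S \<in> column_sets t k"
  obtains l where "N = (\<Prod>j\<in>S. v j) * l"
proof -
  from assms obtain l where l: "\<And>x. x \<in> Pi\<^sub>E S V \<Longrightarrow> row_count N A S x = l"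
    unfolding is_MOA_def by blast
  have S: "S \<subseteq> {1..k}" "finite S"
    using assms(2) by (auto simp: column_sets_def intro: finite_subset)
  with assms(1) have V: "finite (V j)" "card (V j) = v j" if "j \<in> S" for j
    using that by (auto simp: is_MOA_def)
  have "N = (\<Sum>x\<in>Pi\<^sub>E S V. row_count N A S x)"
    using assms(1) S V by (intro sum_row_count[symmetric]) (auto simp: is_MOA_def)
  also have "\<dots> = (\<Prod>j\<in>S. v j) * l"
    using S V l by (simp add: card_PiE)
  finally show ?thesis
    by (rule that)
qed

text \<open>Nonempty symbol sets make the product nonempty; over an empty product every
  \<open>l\<close> would qualify and the description would not be unique.\<close>

lemma moa_index_eqI:
  assumes "\<And>x. x \<in> Pi\<^sub>E S V \<Longrightarrow> row_count N A S x = l" "\<And>j. j \<in> S \<Longrightarrow> V j \<noteq> {}"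
  shows "moa_index N V A S = l"
proof -
  obtain x where "x \<in> Pi\<^sub>E S V"
    using assms(2) by (metis PiE_eq_empty_iff ex_in_conv)
  with assms(1) show ?thesis
    unfolding moa_index_def by (intro the_equality) auto
qed

text \<open>The numbers below \<open>m * w\<close> form \<open>w\<close> complete residue systems
  modulo \<open>m\<close>, and a shift by \<open>s\<close> permutes the residues.\<close>

lemma card_residue_class:
  fixes m s a w :: nat
  assumes "a < m"
  shows "card {c. c < m * w \<and> (c + s) mod m = a} = w"
proof -
  from assms have "m > 0"
    by simp
  \<comment> \<open>The number \<open>a + (m - 1) * s\<close> stands in for \<open>a - s\<close>,
    which natural subtraction could truncate.\<close>
  have "[a + (m - 1) * s + s = a] (mod m)"
  proof -
    have "a + (m - 1) * s + s = a + m * s"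
      using \<open>m > 0\<close> by (cases m) auto
    then show ?thesis
      by (simp only: cong_def mod_mult_self2)
  qed
  then obtain d where d: "(d + s) mod m = a"
    using assms by (auto simp: cong_def)
  define c0 where "c0 = d mod m"
  have c0: "c0 < m" "(c0 + s) mod m = a"
    using d \<open>m > 0\<close> by (auto simp: c0_def mod_simps)
  have "{c. c < m * w \<and> (c + s) mod m = a} = (\<lambda>q. m * q + c0) ` {..<w}"
  proof (intro equalityI subsetI)
    fix c assume "c \<in> {c. c < m * w \<and> (c + s) mod m = a}"
    then have c: "c < m * w" "[c + s = c0 + s] (mod m)"
      using c0 by (auto simp: cong_def)
    from c(2) have "[c = c0] (mod m)"
      by (simp only: cong_add_rcancel_nat)
    then have "c mod m = c0"
      using c0(1) by (simp add: cong_def)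
    then have "c = m * (c div m) + c0"
      by (metis mult_div_mod_eq)
    moreover have "c div m < w"
      using c(1) by (simp add: less_mult_imp_div_less mult.commute)
    ultimately show "c \<in> (\<lambda>q. m * q + c0) ` {..<w}"
      by blast
  next
    fix c assume "c \<in> (\<lambda>q. m * q + c0) ` {..<w}"
    then obtain q where q: "q < w" "c = m * q + c0"
      by blast
    have "m * q + c0 < m * (q + 1)"
      using c0(1) by simp
    also have "\<dots> \<le> m * w"
      using q(1) by (intro mult_le_mono2) simp
    finally show "c \<in> {c. c < m * w \<and> (c + s) mod m = a}"
      using c0(2) q(2) by (simp add: add.assoc)
  qed
  moreover have "inj_on (\<lambda>q. m * q + c0) {..<w}"
    using \<open>m > 0\<close> by (auto simp: inj_on_def)
  ultimately show ?thesis
    by (simp add: card_image)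
qed

text \<open>With all other coordinates fixed, evaluation at \<open>j\<close> is a bijection whose
  inverse overwrites \<open>x\<close> at \<open>j\<close>. Here \<open>x\<close> is arbitrary
  outside \<open>I - {j}\<close>, hence the \<open>restrict\<close> in the inverse.\<close>

lemma card_PiE_free_coordinate:
  assumes "j \<in> I" "\<And>i. i \<in> I - {j} \<Longrightarrow> x i \<in> V i"
  shows "card {y \<in> Pi\<^sub>E I V. (\<forall>i\<in>I - {j}. y i = x i) \<and> P (y j)} = card {c \<in> V j. P c}"
proof -
  let ?Y = "{y \<in> Pi\<^sub>E I V. (\<forall>i\<in>I - {j}. y i = x i) \<and> P (y j)}"
  have "bij_betw (\<lambda>y. y j) ?Y {c \<in> V j. P c}"
  proof (rule bij_betw_byWitness[where f' = "\<lambda>c. (restrict x I)(j := c)"])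
    show "\<forall>y\<in>?Y. (restrict x I)(j := y j) = y"
      by (auto simp: fun_eq_iff PiE_iff extensional_def)
  qed (use assms in \<open>auto simp: PiE_iff extensional_def split: if_splits\<close>)
  then show ?thesis
    by (rule bij_betw_same_card)
qed

theorem theorem4p16:
  fixes t :: nat and v :: "nat \<Rightarrow> nat"
  assumes "t > 0"
    and "\<forall>i\<in>{1..t+1}. v i > 0"
    and "strict_mono_on {1..t+1} v"
  shows "PDIMOA_star_exists (\<Prod>i=2..t+1. v i) t (t+1) v \<longleftrightarrow> (\<forall>i\<in>{2..t+1}. v 1 dvd v i)"
proof
  assume "PDIMOA_star_exists (\<Prod>i=2..t+1. v i) t (t+1) v"
  then obtain V :: "nat \<Rightarrow> nat set" and A where
    moa: "is_MOA (\<Prod>i=2..t+1. v i) t (t+1) v V A"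
    by (auto simp: PDIMOA_star_exists_def is_PDIMOA_star_def is_PDIMOA_def)
  show "\<forall>i\<in>{2..t+1}. v 1 dvd v i"
  proof
    fix j assume j: "j \<in> {2..t+1}"
    \<comment> \<open>\<open>P\<close> is common to both factorizations of the number of rows:
      \<open>v j * P\<close> by definition and \<open>v 1 * P * l\<close> from omitting column
      \<open>j\<close>. Cancelling it leaves \<open>v j = v 1 * l\<close>.\<close>
    define P where "P = (\<Prod>i\<in>{2..t+1} - {j}. v i)"
    have "{1..t+1} - {j} \<in> column_sets t (t+1)"
      using j unfolding column_sets_Suc by simp
    with moa obtain l where "(\<Prod>i=2..t+1. v i) = (\<Prod>i\<in>{1..t+1} - {j}. v i) * l"
      by (rule MOA_card)
    moreover have "{1..t+1} - {j} = insert 1 ({2..t+1} - {j})"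
      using j by auto
    then have "(\<Prod>i\<in>{1..t+1} - {j}. v i) = v 1 * P"
      by (simp add: P_def)
    moreover have "(\<Prod>i=2..t+1. v i) = v j * P"
      unfolding P_def by (rule prod.remove) (use j in auto)
    moreover have "P > 0"
      unfolding P_def by (intro prod_pos) (use assms(2) in auto)
    ultimately have "v j = v 1 * l"
      by (simp add: ac_simps)
    then show "v 1 dvd v j"
      by simp
  qed
next
  assume dvd: "\<forall>i\<in>{2..t+1}. v 1 dvd v i"
  define N where "N = (\<Prod>i=2..t+1. v i)"
  define V where "V = (\<lambda>i. {..<v i})"
  let ?I = "{2..t+1}"
  have "finite (Pi\<^sub>E ?I V)" "card (Pi\<^sub>E ?I V) = N"
    by (auto simp: V_def N_def card_PiE intro: finite_PiE)
  then obtain f where f: "bij_betw f {1..N} (Pi\<^sub>E ?I V)"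
    by (metis card_atLeastAtMost diff_Suc_1 finite_atLeastAtMost finite_same_card_bij)
  define A where "A = (\<lambda>r j. if j = 1 then (\<Sum>i\<in>?I. f r i) mod v 1 else f r j)"
  have v1: "v 1 > 0"
    using assms(2) by simp
  have A_in: "A r j \<in> V j" if "r \<in> {1..N}" "j \<in> {1..t+1}" for r j
  proof -
    have "f r \<in> Pi\<^sub>E ?I V"
      using f that(1) by (auto simp: bij_betw_def)
    with that(2) v1 show ?thesis
      by (auto simp: A_def V_def PiE_iff)
  qed
  \<comment> \<open>Transport along \<open>f\<close> replaces row numbers by tuples
    \<open>y\<close>; the conditional is the entry of row \<open>y\<close> in column
    \<open>i\<close>.\<close>
  have count_rows: "row_count N A S x =
      card {y \<in> Pi\<^sub>E ?I V. \<forall>i\<in>S. (if i = 1 then (\<Sum>i\<in>?I. y i) mod v 1 else y i) = x i}"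
    for S x
  proof -
    let ?Q = "\<lambda>y. \<forall>i\<in>S. (if i = 1 then (\<Sum>i\<in>?I. y i) mod v 1 else y i) = x i"
    have "f ` {r \<in> {1..N}. Q (f r)} = {y \<in> Pi\<^sub>E ?I V. Q y}" for Q
      unfolding bij_betw_imp_surj_on[OF f, symmetric] by blast
    from this[of ?Q]
    have "bij_betw f {r \<in> {1..N}. \<forall>i\<in>S. A r i = x i} {y \<in> Pi\<^sub>E ?I V. ?Q y}"
      unfolding A_def by (rule bij_betw_subset[OF f, rotated]) blast
    then show ?thesis
      unfolding row_count_def by (rule bij_betw_same_card)
  qed
  have count: "row_count N A ({1..t+1} - {j}) x = v j div v 1"
    if j: "j \<in> {1..t+1}" and x: "x \<in> Pi\<^sub>E ({1..t+1} - {j}) V" for j x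
  proof (cases "j = 1")
    case True
    \<comment> \<open>With column 1 omitted, every tuple is a row exactly once, and
      \<open>v 1 div v 1 = 1\<close>.\<close>
    have "{1..t+1} - {1} = ?I"
      by auto
    with x True have x: "x \<in> Pi\<^sub>E ?I V" and S: "{1..t+1} - {j} = ?I"
      by auto
    have "{y \<in> Pi\<^sub>E ?I V. \<forall>i\<in>?I. (if i = 1 then (\<Sum>i\<in>?I. y i) mod v 1 else y i) = x i} = {x}"
      using x by (auto intro: PiE_ext)
    then show ?thesis
      unfolding count_rows S using v1 True by simp
  next
    case False
    with j have j: "j \<in> ?I" and S: "{1..t+1} - {j} = insert 1 (?I - {j})"
      by auto
    define s where "s = (\<Sum>i\<in>?I - {j}. x i)"
    have sum_y: "(\<Sum>i\<in>?I. y i) = y j + s" if "\<forall>i\<in>?I - {j}. y i = x i" for y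
      using that j unfolding s_def by (subst sum.remove[of _ j]) auto
    have split_1: "(\<forall>i\<in>insert 1 (?I - {j}). (if i = 1 then q else y i) = x i) \<longleftrightarrow>
        (\<forall>i\<in>?I - {j}. y i = x i) \<and> q = x 1" for q y
      by auto
    \<comment> \<open>The prescribed checksum in column 1 becomes a condition on \<open>y j\<close>
      alone; \<open>conj_cong\<close> supplies the agreement off \<open>j\<close> that
      \<open>sum_y\<close> needs.\<close>
    have "{y \<in> Pi\<^sub>E ?I V. \<forall>i\<in>{1..t+1} - {j}.
          (if i = 1 then (\<Sum>i\<in>?I. y i) mod v 1 else y i) = x i} =
        {y \<in> Pi\<^sub>E ?I V. (\<forall>i\<in>?I - {j}. y i = x i) \<and> (y j + s) mod v 1 = x 1}"
      unfolding S split_1 by (intro Collect_cong conj_cong refl) (simp only: sum_y)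
    then have "row_count N A ({1..t+1} - {j}) x = card {c \<in> V j. (c + s) mod v 1 = x 1}"
      unfolding count_rows using j x
      by (simp only:) (rule card_PiE_free_coordinate, auto simp: S)
    \<comment> \<open>Divisibility enters here: \<open>V j\<close> consists of
      \<open>v j div v 1\<close> complete residue systems modulo \<open>v 1\<close>. The bound
      \<open>x 1 < v 1\<close> holds because column 1 lies in the set.\<close>
    also have "\<dots> = card {c. c < v 1 * (v j div v 1) \<and> (c + s) mod v 1 = x 1}"
      using dvd j by (simp add: V_def)
    also have "\<dots> = v j div v 1"
      using x unfolding S by (intro card_residue_class) (auto simp: V_def)
    finally show ?thesis .
  qed
  have index: "moa_index N V A ({1..t+1} - {j}) = v j div v 1" if "j \<in> {1..t+1}" for j
    using count that assms(2) by (intro moa_index_eqI) (auto simp: V_def)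
  have "is_MOA N t (t+1) v V A"
    unfolding is_MOA_def column_sets_Suc using A_in count by (auto simp: V_def)
  moreover have "inj_on (moa_index N V A) (column_sets t (t+1))"
  proof -
    have dvd': "v 1 dvd v i" if "i \<in> {1..t+1}" for i
      using dvd that by (cases "i = 1") auto
    \<comment> \<open>Division by the common divisor \<open>v 1\<close> loses no information, so
      equal indices force equal values of \<open>v\<close>, which strict monotonicity excludes for
      distinct columns.\<close>
    have "i = j" if "i \<in> {1..t+1}" "j \<in> {1..t+1}" "v i div v 1 = v j div v 1" for i j
    proof -
      have "v i = v j"
        using that dvd' by (metis dvd_mult_div_cancel)
      then show ?thesis
        using strict_mono_on_imp_inj_on[OF assms(3)] that by (auto dest: inj_onD)
    qed
    then show ?thesis
      unfolding column_sets_Suc inj_on_def ball_simps by (metis index)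
  qed
  moreover have "moa_index N V A ({1..t+1} - {1}) = 1"
    using index[of 1] v1 by simp
  then have "\<exists>S\<in>column_sets t (t+1). moa_index N V A S = 1"
    unfolding column_sets_Suc by (intro bexI[of _ "{1..t+1} - {1}"]) auto
  ultimately show "PDIMOA_star_exists (\<Prod>i=2..t+1. v i) t (t+1) v"
    unfolding PDIMOA_star_exists_def is_PDIMOA_star_def is_PDIMOA_def N_def[symmetric] by blast
qed

end
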